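(* Let $\{G_i\}_{i=1}^n$ be a collection of finite discrete groups and let $K_0$ be the $0$-simplicial complex on $n$ vertices. Let $\rho:\prod_{i=1}^nG_i\to\mathrm{Out}(F_N)$ be the monodromy representation, where $F_N$ is isomorphic to the kernel of the projection $$p:G_1\ast\cdots\ast G_n\to\prod_{i=1}^nG_i.$$ Then the following properties hold: (1) There is a choice of a generating set for $F_N$ that consists of elements of the form $$f=[g_{i_1},[g_{i_2},[\dots,[g_{i_{k-1}},g_{i_k}]\dots]]]\in\Gamma^k(G_1\ast\cdots\ast G_n)$$ such that $g_{i_j}\in G_{i_j}$ for all $i_j$. (2) For any $g\in G_1\ast\cdots\ast G_n$, the map $\rho(g)\in\mathrm{Aut}(F_N)$ satisfies $\rho(g)(f)=\Delta\cdot f$ for each such element $f$, where $\Delta\in\Gamma^{k+1}(G_1\ast\cdots\ast G_n)$. That is, $\Delta$ is trivial in $\mathrm{gr}_p(G_1\ast\cdots\ast G_n)$ for $p\le k$.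
   Context: Commutators are $[x,y]=xyx^{-1}y^{-1}$. For a group $G$, the descending central series is $\Gamma^1(G)=G$, $\Gamma^{q+1}(G)=[\Gamma^q(G),G]$, and $\mathrm{gr}_p(G)=\Gamma^p(G)/\Gamma^{p+1}(G)$. $K_0$ is the simplicial complex with $n$ vertices and no higher-dimensional simplices. For a finite discrete group $G$, $EG$ is a contractible space with a free, properly discontinuous $G$-action, $BG=EG/G$, and $G\subset EG$ is included as an orbit. The polyhedral product is $Z_{K_0}(\underline{EG},\underline G)=\bigcup_{i=1}^n G_1\times\cdots\times G_{i-1}\times EG_i\times G_{i+1}\times\cdots\times G_n\subseteq\prod_i EG_i$. The Denham--Suciu fibration $Z_{K_0}(\underline{EG},\underline G)\to BG_1\vee\cdots\vee BG_n\to\prod_iBG_i$ consists of Eilenberg--Mac Lane spaces $K(\pi,1)$ and gives the short exact sequence $$1\to F_N\to G_1\ast\cdots\ast G_n\xrightarrow{\ p\ }\prod_{i=1}^nG_i\to1,$$ where $F_N\cong\pi_1(Z_{K_0}(\underline{EG},\underline G))$ is a free group of finite rank. The monodromy representation $\rho:\prod_iG_i\to\mathrm{Out}(F_N)=\mathrm{Aut}(F_N)/\mathrm{Inn}(F_N)$ is the homomorphism induced by the conjugation homomorphism $G_1\ast\cdots\ast G_n\to\mathrm{Aut}(F_N)$. For $g\in G_1\ast\cdots\ast G_n$, the notation $\rho(g)\in\mathrm{Aut}(F_N)$ means the conjugation automorphism $\rho(g)(w)=gwg^{-1}$ of $F_N$, which represents the outer class $\rho(p(g))$. The integer $k$ in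 (1) and (2) is the length of the commutator $f$ and may vary with $f$. *)

theory Defs
  imports "HOL-Algebra.Product_Groups" "HOL-Algebra.Bij"
begin

section \<open>Commutators and the descending central series\<close>

definition commutator :: "('g, 'm) monoid_scheme \<Rightarrow> 'g \<Rightarrow> 'g \<Rightarrow> 'g" where
  "commutator G x y = x \<otimes>\<^bsub>G\<^esub> y \<otimes>\<^bsub>G\<^esub> inv\<^bsub>G\<^esub> x \<otimes>\<^bsub>G\<^esub> inv\<^bsub>G\<^esub> y"

definition commutator_subgroup :: "('g, 'm) monoid_scheme \<Rightarrow> 'g set \<Rightarrow> 'g set \<Rightarrow> 'g set" where
  "commutator_subgroup G A B = generate G {commutator G a b | a b. a \<in> A \<and> b \<in> B}"

text \<open>The series is indexed from 1; the value at index 0 is a junk value.\<close>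

fun descending_central :: "('g, 'm) monoid_scheme \<Rightarrow> nat \<Rightarrow> 'g set" where
  "descending_central G 0 = carrier G"
| "descending_central G (Suc 0) = carrier G"
| "descending_central G (Suc (Suc q)) =
     commutator_subgroup G (descending_central G (Suc q)) (carrier G)"

definition gr :: "('g, 'm) monoid_scheme \<Rightarrow> nat \<Rightarrow> 'g set monoid" where
  "gr G q = (G\<lparr>carrier := descending_central G q\<rparr>) Mod descending_central G (q + 1)"

definition gr_class :: "('g, 'm) monoid_scheme \<Rightarrow> nat \<Rightarrow> 'g \<Rightarrow> 'g set" where
  "gr_class G q x = descending_central G (q + 1) #>\<^bsub>G\<lparr>carrier := descending_central G q\<rparr>\<^esub> x"

text \<open>\<open>nested_commutator G [x\<^sub>1, \<dots>, x\<^sub>k] = [x\<^sub>1, [x\<^sub>2, [\<dots>, [x\<^sub>k\<^sub>-\<^sub>1, x\<^sub>k]\<dots>]]]\<close>\<close>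

fun nested_commutator :: "('g, 'm) monoid_scheme \<Rightarrow> 'g list \<Rightarrow> 'g" where
  "nested_commutator G [] = \<one>\<^bsub>G\<^esub>"
| "nested_commutator G [x] = x"
| "nested_commutator G (x # y # zs) = commutator G x (nested_commutator G (y # zs))"


section \<open>Free products\<close>

text \<open>
  The free product is the monoid of words in the letters \<open>(i, x)\<close> with \<open>x \<in> G\<^sub>i\<close>, modulo the
  congruence generated by deleting identity letters and multiplying adjacent letters
  from the same factor.
\<close>

definition free_words :: "'i set \<Rightarrow> ('i \<Rightarrow> ('a, 'b) monoid_scheme) \<Rightarrow> ('i \<times> 'a) list set" where
  "free_words I G = lists (SIGMA i:I. carrier (G i))"

inductive_set free_product_rel ::
    "'i set \<Rightarrow> ('i \<Rightarrow> ('a, 'b) monoid_scheme) \<Rightarrow> (('i \<times> 'a) list \<times> ('i \<times> 'a) list) set"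
  for I :: "'i set" and G :: "'i \<Rightarrow> ('a, 'b) monoid_scheme" where
  word_refl: "w \<in> free_words I G \<Longrightarrow> (w, w) \<in> free_product_rel I G"
| word_sym: "(u, v) \<in> free_product_rel I G \<Longrightarrow> (v, u) \<in> free_product_rel I G"
| word_trans: "(u, v) \<in> free_product_rel I G \<Longrightarrow> (v, w) \<in> free_product_rel I G
    \<Longrightarrow> (u, w) \<in> free_product_rel I G"
| word_unit: "u \<in> free_words I G \<Longrightarrow> v \<in> free_words I G \<Longrightarrow> i \<in> I
    \<Longrightarrow> (u @ (i, \<one>\<^bsub>G i\<^esub>) # v, u @ v) \<in> free_product_rel I G"
| word_merge: "u \<in> free_words I G \<Longrightarrow> v \<in> free_words I G \<Longrightarrow> i \<in> I
    \<Longrightarrow> x \<in> carrier (G i) \<Longrightarrow> y \<in> carrier (G i)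
    \<Longrightarrow> (u @ (i, x) # (i, y) # v, u @ (i, x \<otimes>\<^bsub>G i\<^esub> y) # v) \<in> free_product_rel I G"

definition free_product ::
    "'i set \<Rightarrow> ('i \<Rightarrow> ('a, 'b) monoid_scheme) \<Rightarrow> ('i \<times> 'a) list set monoid" where
  "free_product I G =
     \<lparr>carrier = free_words I G // free_product_rel I G,
      monoid.mult = (\<lambda>A B. \<Union>u\<in>A. \<Union>v\<in>B. free_product_rel I G `` {u @ v}),
      one = free_product_rel I G `` {[]}\<rparr>"

definition free_product_incl ::
    "'i set \<Rightarrow> ('i \<Rightarrow> ('a, 'b) monoid_scheme) \<Rightarrow> 'i \<Rightarrow> 'a \<Rightarrow> ('i \<times> 'a) list set" where
  "free_product_incl I G i x = free_product_rel I G `` {[(i, x)]}"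

text \<open>
  The commutators \<open>[g\<^sub>1, [g\<^sub>2, [\<dots>, [g\<^sub>k\<^sub>-\<^sub>1, g\<^sub>k]\<dots>]]]\<close> of length \<open>k\<close> whose entries each lie in
  some factor of the free product; several entries may come from the same factor.
\<close>

definition nested_commutators ::
    "'i set \<Rightarrow> ('i \<Rightarrow> ('a, 'b) monoid_scheme) \<Rightarrow> nat \<Rightarrow> ('i \<times> 'a) list set set" where
  "nested_commutators I G k =
     {nested_commutator (free_product I G) (map (\<lambda>(i, x). free_product_incl I G i x) w) | w.
        length w = k \<and> w \<in> free_words I G}"

definition word_eval :: "('h, 'c) monoid_scheme \<Rightarrow> ('i \<Rightarrow> 'a \<Rightarrow> 'h) \<Rightarrow> ('i \<times> 'a) list \<Rightarrow> 'h" where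
  "word_eval H f w = foldr (\<lambda>(i, x) h. f i x \<otimes>\<^bsub>H\<^esub> h) w \<one>\<^bsub>H\<^esub>"

text \<open>
  The homomorphism out of the free product determined by homomorphisms \<open>f i\<close> on the factors;
  \<open>word_eval\<close> is constant on equivalence classes (see \<open>free_product_lift_class\<close> below).
\<close>

definition free_product_lift ::
    "('h, 'c) monoid_scheme \<Rightarrow> ('i \<Rightarrow> 'a \<Rightarrow> 'h) \<Rightarrow> ('i \<times> 'a) list set \<Rightarrow> 'h" where
  "free_product_lift H f A = the_elem (word_eval H f ` A)"

definition product_incl ::
    "'i set \<Rightarrow> ('i \<Rightarrow> ('a, 'b) monoid_scheme) \<Rightarrow> 'i \<Rightarrow> 'a \<Rightarrow> 'i \<Rightarrow> 'a" where
  "product_incl I G i x = (\<lambda>j\<in>I. if j = i then x else \<one>\<^bsub>G j\<^esub>)"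

definition free_product_proj ::
    "'i set \<Rightarrow> ('i \<Rightarrow> ('a, 'b) monoid_scheme) \<Rightarrow> ('i \<times> 'a) list set \<Rightarrow> 'i \<Rightarrow> 'a" where
  "free_product_proj I G = free_product_lift (product_group I G) (product_incl I G)"


section \<open>Outer automorphisms and the monodromy representation\<close>

definition kernel_group ::
    "('g, 'm) monoid_scheme \<Rightarrow> ('h, 'c) monoid_scheme \<Rightarrow> ('g \<Rightarrow> 'h) \<Rightarrow> ('g, 'm) monoid_scheme" where
  "kernel_group G H p = G\<lparr>carrier := kernel G H p\<rparr>"

definition conj_aut :: "('g, 'm) monoid_scheme \<Rightarrow> 'g set \<Rightarrow> 'g \<Rightarrow> 'g \<Rightarrow> 'g" where
  "conj_aut G N g = (\<lambda>x\<in>N. g \<otimes>\<^bsub>G\<^esub> x \<otimes>\<^bsub>G\<^esub> inv\<^bsub>G\<^esub> g)"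

definition inner_auts :: "('g, 'm) monoid_scheme \<Rightarrow> ('g \<Rightarrow> 'g) set" where
  "inner_auts G = conj_aut G (carrier G) ` carrier G"

definition OutGroup :: "('g, 'm) monoid_scheme \<Rightarrow> ('g \<Rightarrow> 'g) set monoid" where
  "OutGroup G = AutoGroup G Mod inner_auts G"

definition outer_class :: "('g, 'm) monoid_scheme \<Rightarrow> ('g \<Rightarrow> 'g) \<Rightarrow> ('g \<Rightarrow> 'g) set" where
  "outer_class G a = inner_auts G #>\<^bsub>AutoGroup G\<^esub> a"

text \<open>
  For a surjective homomorphism \<open>p : G \<rightarrow> H\<close>, conjugation of \<open>G\<close> on \<open>ker p\<close> induces a homomorphism
  from \<open>H\<close> to \<open>Out (ker p)\<close>: all lifts \<open>g\<close> of \<open>x\<close> act by the same outer class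
  (see \<open>monodromy_apply\<close> and \<open>monodromy_hom\<close> below).
\<close>

definition monodromy ::
    "('g, 'm) monoid_scheme \<Rightarrow> ('h, 'c) monoid_scheme \<Rightarrow> ('g \<Rightarrow> 'h) \<Rightarrow> 'h \<Rightarrow> ('g \<Rightarrow> 'g) set" where
  "monodromy G H p = (\<lambda>x\<in>carrier H. the_elem
     ((\<lambda>g. outer_class (kernel_group G H p) (conj_aut G (kernel G H p) g))
        ` {g \<in> carrier G. p g = x}))"


section \<open>Well-definedness\<close>

lemma free_words_append [simp]:
  "u @ v \<in> free_words I G \<longleftrightarrow> u \<in> free_words I G \<and> v \<in> free_words I G"
  by (auto simp: free_words_def)

lemma free_words_Cons [simp]:
  "(i, x) # v \<in> free_words I G \<longleftrightarrow> i \<in> I \<and> x \<in> carrier (G i) \<and> v \<in> free_words I G"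
  by (auto simp: free_words_def)

lemma free_words_Nil [simp]: "[] \<in> free_words I G"
  by (auto simp: free_words_def)

locale group_family =
  fixes I :: "'i set" and G :: "'i \<Rightarrow> ('a, 'b) monoid_scheme"
  assumes grp: "\<And>i. i \<in> I \<Longrightarrow> group (G i)"
begin

abbreviation "R \<equiv> free_product_rel I G"
abbreviation "W \<equiv> free_words I G"

lemma rel_words: "(u, v) \<in> R \<Longrightarrow> u \<in> W \<and> v \<in> W"
  by (induction rule: free_product_rel.induct) (auto simp: grp group.is_monoid monoid.m_closed)

lemma equiv_rel: "equiv W R"
proof (rule equivI)
  show "R \<subseteq> W \<times> W" using rel_words by auto
  show "refl_on W R" by (auto simp: refl_on_def free_product_rel.word_refl)
  show "sym R" by (auto intro: symI word_sym)
  show "trans R" by (blast intro: transI word_trans)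
qed

lemma rel_append:
  assumes "(u, v) \<in> R" "a \<in> W" "b \<in> W"
  shows "(a @ u @ b, a @ v @ b) \<in> R"
  using assms(1)
proof (induction rule: free_product_rel.induct)
  case (word_unit u v i)
  show ?case using free_product_rel.word_unit[of "a @ u" I G "v @ b" i] word_unit assms by simp
next
  case (word_merge u v i x y)
  show ?case using free_product_rel.word_merge[of "a @ u" I G "v @ b" i x y] word_merge assms by simp
next
  case (word_refl w)
  then show ?case using assms by (intro free_product_rel.word_refl) simp
next
  case (word_sym u v)
  show ?case by (rule free_product_rel.word_sym[OF word_sym.IH])
next
  case (word_trans u v w)
  show ?case by (rule free_product_rel.word_trans[OF word_trans.IH])
qed

lemma rel_append2:
  assumes "(u, u') \<in> R" "(v, v') \<in> R"
  shows "(u @ v, u' @ v') \<in> R"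
proof (rule word_trans)
  show "(u @ v, u' @ v) \<in> R"
    using rel_append[OF assms(1), of "[]" v] rel_words[OF assms(2)] by simp
  show "(u' @ v, u' @ v') \<in> R"
    using rel_append[OF assms(2), of u' "[]"] rel_words[OF assms(1)] by simp
qed

lemma class_mult:
  assumes "u \<in> W" "v \<in> W"
  shows "R `` {u} \<otimes>\<^bsub>free_product I G\<^esub> R `` {v} = R `` {u @ v}"
proof -
  have "R `` {a @ b} = R `` {u @ v}" if "a \<in> R `` {u}" "b \<in> R `` {v}" for a b
  proof -
    have "(u @ v, a @ b) \<in> R" using that by (intro rel_append2) auto
    from equiv_class_eq[OF equiv_rel this] show ?thesis by (rule sym)
  qed
  moreover have "u \<in> R `` {u}" "v \<in> R `` {v}"
    using assms by (auto intro: free_product_rel.word_refl)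
  ultimately have "(\<Union>a\<in>R `` {u}. \<Union>b\<in>R `` {v}. R `` {a @ b}) = R `` {u @ v}" by blast
  then show ?thesis by (simp add: free_product_def)
qed

lemma class_in_carrier: "u \<in> W \<Longrightarrow> R `` {u} \<in> carrier (free_product I G)"
  by (simp add: free_product_def quotientI)

lemma carrier_cases:
  assumes "A \<in> carrier (free_product I G)"
  obtains u where "u \<in> W" "A = R `` {u}"
  using assms by (auto simp: free_product_def elim: quotientE)

definition inv_word :: "('i \<times> 'a) list \<Rightarrow> ('i \<times> 'a) list" where
  "inv_word w = rev (map (\<lambda>(i, x). (i, inv\<^bsub>G i\<^esub> x)) w)"

lemma inv_word: "w \<in> W \<Longrightarrow> inv_word w \<in> W \<and> (inv_word w @ w, []) \<in> R"
proof (induction w)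
  case Nil
  show ?case by (auto simp: inv_word_def intro: free_product_rel.word_refl)
next
  case (Cons a w)
  obtain i x where a: "a = (i, x)" by force
  then have ix: "i \<in> I" "x \<in> carrier (G i)" "w \<in> W" using Cons.prems by auto
  interpret Gi: group "G i" using grp ix by blast
  have w: "inv_word w \<in> W" "(inv_word w @ w, []) \<in> R" using Cons.IH ix by auto
  have e: "inv_word (a # w) = inv_word w @ [(i, inv\<^bsub>G i\<^esub> x)]" by (simp add: a inv_word_def)
  have "(inv_word w @ (i, inv\<^bsub>G i\<^esub> x) # (i, x) # w, inv_word w @ (i, \<one>\<^bsub>G i\<^esub>) # w) \<in> R"
    using word_merge[of "inv_word w" I G w i "inv\<^bsub>G i\<^esub> x" x] w ix by simp
  moreover have "(inv_word w @ (i, \<one>\<^bsub>G i\<^esub>) # w, inv_word w @ w) \<in> R"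
    using w ix by (intro word_unit) auto
  ultimately have "(inv_word w @ (i, inv\<^bsub>G i\<^esub> x) # (i, x) # w, []) \<in> R"
    using w(2) by (blast intro: word_trans)
  then show ?case using w ix e a by simp
qed

lemma group_free_product: "group (free_product I G)"
proof (rule groupI)
  have one: "\<one>\<^bsub>free_product I G\<^esub> = R `` {[]}" by (simp add: free_product_def)
  show "\<one>\<^bsub>free_product I G\<^esub> \<in> carrier (free_product I G)"
    unfolding one by (simp add: class_in_carrier)
  fix x assume "x \<in> carrier (free_product I G)"
  then obtain u where u: "u \<in> W" "x = R `` {u}" by (rule carrier_cases)
  show "\<one>\<^bsub>free_product I G\<^esub> \<otimes>\<^bsub>free_product I G\<^esub> x = x"
    using u by (simp add: one class_mult)
  have "R `` {inv_word u} \<otimes>\<^bsub>free_product I G\<^esub> x = \<one>\<^bsub>free_product I G\<^esub>"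
    using u inv_word[OF u(1)] equiv_class_eq[OF equiv_rel, of "inv_word u @ u" "[]"]
    by (simp add: one class_mult)
  then show "\<exists>y\<in>carrier (free_product I G). y \<otimes>\<^bsub>free_product I G\<^esub> x = \<one>\<^bsub>free_product I G\<^esub>"
    using inv_word[OF u(1)] class_in_carrier[of "inv_word u"] by blast
  fix y assume "y \<in> carrier (free_product I G)"
  then obtain v where v: "v \<in> W" "y = R `` {v}" by (rule carrier_cases)
  show "x \<otimes>\<^bsub>free_product I G\<^esub> y \<in> carrier (free_product I G)"
    using u v by (simp add: class_mult class_in_carrier)
  fix z assume "z \<in> carrier (free_product I G)"
  then obtain w where w: "w \<in> W" "z = R `` {w}" by (rule carrier_cases)
  show "x \<otimes>\<^bsub>free_product I G\<^esub> y \<otimes>\<^bsub>free_product I G\<^esub> z =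
      x \<otimes>\<^bsub>free_product I G\<^esub> (y \<otimes>\<^bsub>free_product I G\<^esub> z)"
    using u v w by (simp add: class_mult)
qed

lemma free_product_incl_hom:
  assumes "i \<in> I"
  shows "free_product_incl I G i \<in> hom (G i) (free_product I G)"
proof (rule homI)
  interpret Gi: group "G i" using grp assms by blast
  fix x y assume xy: "x \<in> carrier (G i)" "y \<in> carrier (G i)"
  show "free_product_incl I G i x \<in> carrier (free_product I G)"
    using xy assms by (simp add: free_product_incl_def class_in_carrier)
  have "([(i, x), (i, y)], [(i, x \<otimes>\<^bsub>G i\<^esub> y)]) \<in> R"
    using word_merge[of "[]" I G "[]" i x y] xy assms by simp
  then have "R `` {[(i, x), (i, y)]} = R `` {[(i, x \<otimes>\<^bsub>G i\<^esub> y)]}"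
    by (rule equiv_class_eq[OF equiv_rel])
  then show "free_product_incl I G i (x \<otimes>\<^bsub>G i\<^esub> y) =
      free_product_incl I G i x \<otimes>\<^bsub>free_product I G\<^esub> free_product_incl I G i y"
    using xy assms by (simp add: free_product_incl_def class_mult)
qed

end

locale group_family_lift = group_family I G + H: group H
  for I :: "'i set" and G :: "'i \<Rightarrow> ('a, 'b) monoid_scheme" and H :: "('h, 'c) monoid_scheme" +
  fixes f :: "'i \<Rightarrow> 'a \<Rightarrow> 'h"
  assumes f_hom: "\<And>i. i \<in> I \<Longrightarrow> f i \<in> hom (G i) H"
begin

lemma word_eval_Nil [simp]: "word_eval H f [] = \<one>\<^bsub>H\<^esub>"
  by (simp add: word_eval_def)

lemma word_eval_Cons [simp]: "word_eval H f ((i, x) # w) = f i x \<otimes>\<^bsub>H\<^esub> word_eval H f w"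
  by (simp add: word_eval_def)

lemma f_closed: "i \<in> I \<Longrightarrow> x \<in> carrier (G i) \<Longrightarrow> f i x \<in> carrier H"
  using f_hom by (auto simp: hom_def)

lemma word_eval_closed: "w \<in> W \<Longrightarrow> word_eval H f w \<in> carrier H"
  by (induction w) (auto simp: f_closed)

lemma word_eval_append:
  "u \<in> W \<Longrightarrow> v \<in> W \<Longrightarrow> word_eval H f (u @ v) = word_eval H f u \<otimes>\<^bsub>H\<^esub> word_eval H f v"
  by (induction u) (auto simp: f_closed word_eval_closed H.m_assoc)

lemma word_eval_rel: "(u, v) \<in> R \<Longrightarrow> word_eval H f u = word_eval H f v"
proof (induction rule: free_product_rel.induct)
  case (word_unit u v i)
  have "f i \<one>\<^bsub>G i\<^esub> = \<one>\<^bsub>H\<^esub>"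
    using hom_one[OF f_hom[OF word_unit(3)]] grp[OF word_unit(3)] H.is_group by blast
  then show ?case using word_unit grp[OF word_unit(3)]
    by (simp add: word_eval_append word_eval_closed group.is_monoid monoid.one_closed)
next
  case (word_merge u v i x y)
  then show ?case using grp[OF word_merge(3)] hom_mult[OF f_hom[OF word_merge(3)]]
    by (simp add: word_eval_append word_eval_closed f_closed H.m_assoc group.is_monoid monoid.m_closed)
qed auto

lemma free_product_lift_class:
  assumes "w \<in> W"
  shows "free_product_lift H f (R `` {w}) = word_eval H f w"
proof -
  have "word_eval H f ` (R `` {w}) = {word_eval H f w}"
  proof
    show "word_eval H f ` (R `` {w}) \<subseteq> {word_eval H f w}"
      by (auto dest: word_eval_rel)
    show "{word_eval H f w} \<subseteq> word_eval H f ` (R `` {w})"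
      using word_refl[OF assms] by auto
  qed
  then show ?thesis by (simp add: free_product_lift_def)
qed

lemma free_product_lift_hom: "free_product_lift H f \<in> hom (free_product I G) H"
proof (rule homI)
  fix x y assume x: "x \<in> carrier (free_product I G)" and y: "y \<in> carrier (free_product I G)"
  obtain u where u: "u \<in> W" "x = R `` {u}" using x by (rule carrier_cases)
  obtain v where v: "v \<in> W" "y = R `` {v}" using y by (rule carrier_cases)
  show "free_product_lift H f x \<in> carrier H"
    using u by (simp add: free_product_lift_class word_eval_closed)
  show "free_product_lift H f (x \<otimes>\<^bsub>free_product I G\<^esub> y) =
      free_product_lift H f x \<otimes>\<^bsub>H\<^esub> free_product_lift H f y"
    using u v by (simp add: free_product_lift_class class_mult word_eval_append)
qed

lemma free_product_lift_incl:
  "i \<in> I \<Longrightarrow> x \<in> carrier (G i) \<Longrightarrow> free_product_lift H f (free_product_incl I G i x) = f i x"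
  by (simp add: free_product_incl_def free_product_lift_class f_closed)

lemma free_product_lift_unique:
  assumes h: "h \<in> hom (free_product I G) H"
    and hf: "\<And>i x. i \<in> I \<Longrightarrow> x \<in> carrier (G i) \<Longrightarrow> h (free_product_incl I G i x) = f i x"
    and A: "A \<in> carrier (free_product I G)"
  shows "h A = free_product_lift H f A"
proof -
  have "h (R `` {w}) = word_eval H f w" if "w \<in> W" for w
    using that
  proof (induction w)
    case Nil
    have "h \<one>\<^bsub>free_product I G\<^esub> = \<one>\<^bsub>H\<^esub>"
      using hom_one[OF h group_free_product H.is_group] .
    then show ?case by (simp add: free_product_def)
  next
    case (Cons a w)
    obtain i x where a: "a = (i, x)" by force
    then have ix: "i \<in> I" "x \<in> carrier (G i)" "w \<in> W" using Cons.prems by auto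
    have "R `` {a # w} = free_product_incl I G i x \<otimes>\<^bsub>free_product I G\<^esub> R `` {w}"
      using ix a class_mult[of "[(i, x)]" w] by (simp add: free_product_incl_def)
    moreover have "free_product_incl I G i x \<in> carrier (free_product I G)"
      using ix by (simp add: free_product_incl_def class_in_carrier)
    ultimately show ?case
      using ix a Cons.IH hf hom_mult[OF h] by (simp add: class_in_carrier)
  qed
  moreover obtain w where "w \<in> W" "A = R `` {w}" using A by (rule carrier_cases)
  ultimately show ?thesis by (simp add: free_product_lift_class)
qed

end

context group_family
begin

lemma product_incl_hom:
  assumes "i \<in> I"
  shows "product_incl I G i \<in> hom (G i) (product_group I G)"
proof (rule homI)
  have one: "\<one>\<^bsub>G j\<^esub> \<in> carrier (G j)" "\<one>\<^bsub>G j\<^esub> \<otimes>\<^bsub>G j\<^esub> \<one>\<^bsub>G j\<^esub> = \<one>\<^bsub>G j\<^esub>" if "j \<in> I" for j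
  proof -
    interpret group "G j" using grp that by blast
    show "\<one>\<^bsub>G j\<^esub> \<in> carrier (G j)" "\<one>\<^bsub>G j\<^esub> \<otimes>\<^bsub>G j\<^esub> \<one>\<^bsub>G j\<^esub> = \<one>\<^bsub>G j\<^esub>" by simp_all
  qed
  fix x y assume "x \<in> carrier (G i)" "y \<in> carrier (G i)"
  then show "product_incl I G i x \<in> carrier (product_group I G)"
    "product_incl I G i (x \<otimes>\<^bsub>G i\<^esub> y) =
      product_incl I G i x \<otimes>\<^bsub>product_group I G\<^esub> product_incl I G i y"
    using one by (auto simp: product_incl_def fun_eq_iff)
qed

sublocale proj: group_family_lift I G "product_group I G" "product_incl I G"
  by (intro group_family_lift.intro group_family_lift_axioms.intro group_family_axioms
      product_group product_incl_hom grp)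

lemma free_product_proj_hom: "free_product_proj I G \<in> hom (free_product I G) (product_group I G)"
  unfolding free_product_proj_def by (rule proj.free_product_lift_hom)

lemma free_product_proj_incl:
  "i \<in> I \<Longrightarrow> x \<in> carrier (G i) \<Longrightarrow>
    free_product_proj I G (free_product_incl I G i x) = product_incl I G i x"
  unfolding free_product_proj_def by (rule proj.free_product_lift_incl)

lemma product_incl_apply: "i \<in> I \<Longrightarrow> product_incl I G i x i = x"
  by (simp add: product_incl_def)

lemma free_product_incl_inj: "i \<in> I \<Longrightarrow> inj_on (free_product_incl I G i) (carrier (G i))"
  using free_product_proj_incl
  by (intro inj_onI) (metis (no_types, lifting) product_incl_apply)

lemma free_product_proj_surj:
  assumes "finite I"
  shows "free_product_proj I G ` carrier (free_product I G) = carrier (product_group I G)"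
proof
  interpret P: group "free_product I G" by (rule group_free_product)
  show "free_product_proj I G ` carrier (free_product I G) \<subseteq> carrier (product_group I G)"
    using free_product_proj_hom by (auto simp: hom_def)
  show "carrier (product_group I G) \<subseteq> free_product_proj I G ` carrier (free_product I G)"
  proof
    fix y assume y: "y \<in> carrier (product_group I G)"
    have "(\<lambda>j\<in>I. if j \<in> J then y j else \<one>\<^bsub>G j\<^esub>)
        \<in> free_product_proj I G ` carrier (free_product I G)" if "J \<subseteq> I" for J
      using finite_subset[OF that assms] that
    proof (induction J rule: finite_induct)
      case empty
      have "free_product_proj I G \<one>\<^bsub>free_product I G\<^esub> = \<one>\<^bsub>product_group I G\<^esub>"
        using hom_one[OF free_product_proj_hom group_free_product proj.H.is_group] .
      then show ?case by (intro image_eqI[OF _ P.one_closed]) simp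
    next
      case (insert i J)
      then obtain g where g: "g \<in> carrier (free_product I G)"
        "free_product_proj I G g = (\<lambda>j\<in>I. if j \<in> J then y j else \<one>\<^bsub>G j\<^esub>)"
        by (auto simp del: restrict_apply dest: sym)
      have i: "i \<in> I" "y i \<in> carrier (G i)" using insert y by auto
      have c: "free_product_incl I G i (y i) \<in> carrier (free_product I G)"
        using i by (simp add: free_product_incl_def class_in_carrier)
      have "free_product_proj I G (free_product_incl I G i (y i) \<otimes>\<^bsub>free_product I G\<^esub> g)
          = product_incl I G i (y i) \<otimes>\<^bsub>product_group I G\<^esub> (\<lambda>j\<in>I. if j \<in> J then y j else \<one>\<^bsub>G j\<^esub>)"
        using hom_mult[OF free_product_proj_hom c g(1)] g i by (simp add: free_product_proj_incl)
      also have "\<dots> = (\<lambda>j\<in>I. if j \<in> insert i J then y j else \<one>\<^bsub>G j\<^esub>)"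
      proof -
        have "\<one>\<^bsub>G j\<^esub> \<otimes>\<^bsub>G j\<^esub> \<one>\<^bsub>G j\<^esub> = \<one>\<^bsub>G j\<^esub> \<and> \<one>\<^bsub>G j\<^esub> \<otimes>\<^bsub>G j\<^esub> y j = y j \<and> y j \<otimes>\<^bsub>G j\<^esub> \<one>\<^bsub>G j\<^esub> = y j"
          if "j \<in> I" for j
        proof -
          interpret group "G j" using grp that by blast
          have "y j \<in> carrier (G j)" using y that by auto
          then show ?thesis by simp
        qed
        then show ?thesis using insert.hyps by (auto simp: product_incl_def fun_eq_iff)
      qed
      finally show ?case using P.m_closed[OF c g(1)] by (intro image_eqI[OF sym])
    qed
    from this[of I] have "restrict y I \<in> free_product_proj I G ` carrier (free_product I G)"
      by (simp cong: restrict_cong)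
    then show "y \<in> free_product_proj I G ` carrier (free_product I G)"
      using y by (simp add: PiE_restrict)
  qed
qed

end

locale kernel_conj = group_hom
begin

abbreviation "N \<equiv> kernel G H h"
abbreviation "K \<equiv> kernel_group G H h"

lemma kernel_group_simps [simp]:
  "carrier K = N" "monoid.mult K = monoid.mult G" "one K = one G"
  by (simp_all add: kernel_group_def)

lemma group_kernel_group: "group K"
  unfolding kernel_group_def using subgroup_kernel G.subgroup_imp_group by blast

lemma inv_kernel_group: "x \<in> N \<Longrightarrow> inv\<^bsub>K\<^esub> x = inv\<^bsub>G\<^esub> x"
  unfolding kernel_group_def using subgroup_kernel G.m_inv_consistent by blast

lemma N_closed: "x \<in> N \<Longrightarrow> x \<in> carrier G"
  by (simp add: kernel_def)

lemma conj_in_N: "g \<in> carrier G \<Longrightarrow> x \<in> N \<Longrightarrow> g \<otimes> x \<otimes> inv g \<in> N"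
  using normal_kernel by (meson G.normal_invE(2))

lemma conj_aut_compose:
  assumes "a \<in> carrier G" "b \<in> carrier G"
  shows "compose N (conj_aut G N a) (conj_aut G N b) = conj_aut G N (a \<otimes> b)"
  using assms
  by (auto simp: compose_def conj_aut_def conj_in_N intro!: restrict_ext)
    (simp add: N_closed G.m_assoc G.inv_mult_group)

lemma conj_aut_one: "conj_aut G N \<one> = (\<lambda>x\<in>N. x)"
  by (auto simp: conj_aut_def N_closed intro!: restrict_ext)

lemma conj_aut_in_auto:
  assumes g: "g \<in> carrier G"
  shows "conj_aut G N g \<in> auto K"
proof -
  have inv: "conj_aut G N (inv a) (conj_aut G N a x) = x"
    if "a \<in> carrier G" "x \<in> N" for a x
    using that fun_cong[OF conj_aut_compose[of "inv a" a], of x]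
    by (simp add: conj_aut_one compose_def)
  have "conj_aut G N a \<in> N \<rightarrow> N" if "a \<in> carrier G" for a
    using that by (simp add: conj_aut_def conj_in_N)
  then have "bij_betw (conj_aut G N g) N N"
    using g inv[of g] inv[of "inv g"] by (intro bij_betwI[where g = "conj_aut G N (inv g)"]) simp_all
  moreover have "conj_aut G N g \<in> hom K K"
  proof (rule homI)
    fix x y assume "x \<in> carrier K" "y \<in> carrier K"
    then have xy: "x \<in> N" "y \<in> N" by auto
    show "conj_aut G N g x \<in> carrier K" using xy g by (simp add: conj_aut_def conj_in_N)
    have xyN: "x \<otimes> y \<in> N" using xy subgroup_kernel by (simp add: subgroup.m_closed)
    have xyG: "x \<in> carrier G" "y \<in> carrier G" using xy N_closed by auto
    have "inv g \<otimes> (g \<otimes> z) = z" if "z \<in> carrier G" for z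
      using that g by (simp add: G.m_assoc[symmetric])
    then show "conj_aut G N g (x \<otimes>\<^bsub>K\<^esub> y) = conj_aut G N g x \<otimes>\<^bsub>K\<^esub> conj_aut G N g y"
      using xy xyN xyG g by (simp add: conj_aut_def G.m_assoc)
  qed
  moreover have "conj_aut G N g \<in> extensional N" by (simp add: conj_aut_def)
  ultimately show ?thesis by (simp add: auto_def Bij_def)
qed

lemma AutoGroup_mult: "a \<in> auto K \<Longrightarrow> b \<in> auto K \<Longrightarrow> a \<otimes>\<^bsub>AutoGroup K\<^esub> b = compose N a b"
  by (simp add: AutoGroup_def BijGroup_def auto_def)

lemma conj_aut_kernel: "n \<in> N \<Longrightarrow> conj_aut K (carrier K) n = conj_aut G N n"
  by (simp add: conj_aut_def inv_kernel_group)

lemma inner_auts_eq: "inner_auts K = conj_aut G N ` N"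
  unfolding inner_auts_def kernel_group_simps(1)
  by (rule image_cong) (use conj_aut_kernel in simp_all)

lemma conj_aut_hom: "conj_aut G N \<in> hom G (AutoGroup K)"
proof (rule homI)
  fix a b assume ab: "a \<in> carrier G" "b \<in> carrier G"
  show "conj_aut G N a \<in> carrier (AutoGroup K)"
    using conj_aut_in_auto[OF ab(1)] by (simp add: AutoGroup_def)
  show "conj_aut G N (a \<otimes> b) = conj_aut G N a \<otimes>\<^bsub>AutoGroup K\<^esub> conj_aut G N b"
    using ab by (simp add: AutoGroup_mult conj_aut_in_auto conj_aut_compose)
qed

end

lemma (in group) inner_auts_normal: "inner_auts G \<lhd> AutoGroup G"
proof -
  have T: "kernel_conj G G (\<lambda>_. \<one>)"
    by (intro kernel_conj.intro group_hom.intro group_hom_axioms.intro) (auto simp: hom_def)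
  have N: "kernel G G (\<lambda>_. \<one>) = carrier G" by (auto simp: kernel_def)
  have K: "kernel_group G G (\<lambda>_. \<one>) = G" by (simp add: kernel_group_def N)
  interpret A: group "AutoGroup G" by (rule AutoGroup)
  have c: "conj_aut G (carrier G) \<in> hom G (AutoGroup G)"
    using kernel_conj.conj_aut_hom[OF T] by (simp add: N K)
  interpret c: group_hom G "AutoGroup G" "conj_aut G (carrier G)"
    by unfold_locales (rule c)
  have carrier: "carrier (AutoGroup G) = auto G" by (simp add: AutoGroup_def)
  have "a \<otimes>\<^bsub>AutoGroup G\<^esub> x \<otimes>\<^bsub>AutoGroup G\<^esub> inv\<^bsub>AutoGroup G\<^esub> a \<in> inner_auts G"
    if a: "a \<in> carrier (AutoGroup G)" and x: "x \<in> inner_auts G" for a x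
  proof -
    obtain g where g: "g \<in> carrier G" "x = conj_aut G (carrier G) g"
      using x by (auto simp: inner_auts_def)
    have ah: "a \<in> hom G G" and ab: "a \<in> Bij (carrier G)"
      using a by (auto simp: carrier auto_def)
    interpret a: group_hom G G a by unfold_locales (rule ah)
    have ag: "a g \<in> carrier G" using g by simp
    have xc: "x \<in> carrier (AutoGroup G)" and yc: "conj_aut G (carrier G) (a g) \<in> carrier (AutoGroup G)"
      using g ag by simp_all
    have m: "u \<otimes>\<^bsub>AutoGroup G\<^esub> v = compose (carrier G) u v"
      if "u \<in> carrier (AutoGroup G)" "v \<in> carrier (AutoGroup G)" for u v
      using kernel_conj.AutoGroup_mult[OF T, of u v] that by (simp add: N K carrier)
    have "a \<otimes>\<^bsub>AutoGroup G\<^esub> x = conj_aut G (carrier G) (a g) \<otimes>\<^bsub>AutoGroup G\<^esub> a"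
      unfolding m[OF a xc] m[OF yc a]
      using g by (auto simp: compose_def conj_aut_def intro!: restrict_ext)
    then have "a \<otimes>\<^bsub>AutoGroup G\<^esub> x \<otimes>\<^bsub>AutoGroup G\<^esub> inv\<^bsub>AutoGroup G\<^esub> a = conj_aut G (carrier G) (a g)"
      using a xc yc by (simp add: A.m_assoc)
    then show ?thesis using ag by (auto simp: inner_auts_def)
  qed
  then show ?thesis
    using c.img_is_subgroup by (simp add: A.normal_inv_iff inner_auts_def)
qed

context kernel_conj
begin

lemma outer_class_hom: "(\<lambda>g. outer_class K (conj_aut G N g)) \<in> hom G (OutGroup K)"
proof -
  interpret K: group K by (rule group_kernel_group)
  interpret I: normal "inner_auts K" "AutoGroup K" by (rule K.inner_auts_normal)
  show ?thesis
    unfolding outer_class_def OutGroup_def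
    using hom_in_carrier[OF conj_aut_hom] Group.hom_mult[OF conj_aut_hom]
      hom_in_carrier[OF I.r_coset_hom_Mod] Group.hom_mult[OF I.r_coset_hom_Mod]
    by (intro homI) simp_all
qed

lemma outer_class_kernel:
  assumes "n \<in> N"
  shows "outer_class K (conj_aut G N n) = inner_auts K"
proof -
  interpret K: group K by (rule group_kernel_group)
  interpret I: normal "inner_auts K" "AutoGroup K" by (rule K.inner_auts_normal)
  show ?thesis
    unfolding outer_class_def
    by (rule I.rcos_const[OF K.AutoGroup]) (use assms in \<open>simp add: inner_auts_eq\<close>)
qed

lemma monodromy_apply:
  assumes g: "g \<in> carrier G"
  shows "monodromy G H h (h g) = outer_class K (conj_aut G N g)"
proof -
  interpret K: group K by (rule group_kernel_group)
  interpret I: normal "inner_auts K" "AutoGroup K" by (rule K.inner_auts_normal)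
  interpret O: group "OutGroup K" unfolding OutGroup_def by (rule I.factorgroup_is_group)
  have "outer_class K (conj_aut G N a) = outer_class K (conj_aut G N g)"
    if a: "a \<in> carrier G" "h a = h g" for a
  proof -
    define n where "n = a \<otimes> inv g"
    have n: "n \<in> N" using a g by (simp add: n_def kernel_def)
    have an: "a = n \<otimes> g" using a g by (simp add: n_def G.m_assoc)
    have "outer_class K (conj_aut G N a)
        = outer_class K (conj_aut G N n) \<otimes>\<^bsub>OutGroup K\<^esub> outer_class K (conj_aut G N g)"
      unfolding an using Group.hom_mult[OF outer_class_hom N_closed[OF n] g] .
    also have "outer_class K (conj_aut G N n) = \<one>\<^bsub>OutGroup K\<^esub>"
      using outer_class_kernel[OF n] by (simp add: OutGroup_def)
    finally show ?thesis using hom_in_carrier[OF outer_class_hom g] by simp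
  qed
  note const = this
  have "(\<lambda>a. outer_class K (conj_aut G N a)) ` {a \<in> carrier G. h a = h g}
      = {outer_class K (conj_aut G N g)}"
  proof
    show "(\<lambda>a. outer_class K (conj_aut G N a)) ` {a \<in> carrier G. h a = h g}
        \<subseteq> {outer_class K (conj_aut G N g)}"
      by (auto dest: const)
  qed (use g in auto)
  then show ?thesis using g by (simp add: monodromy_def)
qed

lemma monodromy_hom:
  assumes "h ` carrier G = carrier H"
  shows "monodromy G H h \<in> hom H (OutGroup K)"
proof (rule homI)
  fix x y assume "x \<in> carrier H" "y \<in> carrier H"
  then obtain a b where ab: "a \<in> carrier G" "b \<in> carrier G" "x = h a" "y = h b"
    using assms by (metis imageE)
  show "monodromy G H h x \<in> carrier (OutGroup K)"
    using ab hom_in_carrier[OF outer_class_hom] by (simp add: monodromy_apply)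
  have "x \<otimes>\<^bsub>H\<^esub> y = h (a \<otimes> b)" using ab by simp
  then show "monodromy G H h (x \<otimes>\<^bsub>H\<^esub> y)
      = monodromy G H h x \<otimes>\<^bsub>OutGroup K\<^esub> monodromy G H h y"
    using ab Group.hom_mult[OF outer_class_hom ab(1,2)] monodromy_apply[of "a \<otimes> b"]
    by (simp add: monodromy_apply)
qed

end

end

theory Submission
  imports Defs
begin

text \<open>
  Write \<open>P\<close> for the free product, \<open>p\<close> for its projection onto the direct product, and \<open>S\<close> for the
  set of all nested commutators of length at least 2 with entries in the factors that lie in
  \<open>ker p\<close>.  Let \<open>M\<close> be the subgroup generated by \<open>S\<close>; the claim is that \<open>M = ker p\<close>.

  The identity \<open>a s a\<inverse> = [a, s] s\<close> shows that \<open>M\<close> is stable under conjugation by the elements \<open>a\<close>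
  of the factors: \<open>[a, s]\<close> is again in \<open>S\<close>, since prepending \<open>a\<close> makes the commutator longer and
  \<open>ker p\<close> is normal (\<open>letter_conj_generate_kernel_commutators\<close>).  Moreover \<open>[b, a]\<close> is in \<open>S\<close>
  whenever \<open>a\<close> and \<open>b\<close> come from different factors.  Hence, modulo \<open>M\<close>, all letters of a word that
  belong to one fixed factor can be moved to the front and merged
  (\<open>collect_letters\<close>).  If the word represents an element of \<open>ker p\<close>, the merged letter is
  trivial, so it can be dropped, and the factors are eliminated one after the other
  (\<open>kernel_words_generated\<close>).

  The second part is the same identity once more: with \<open>\<Delta> = [g, f]\<close> we have
  \<open>g f g\<inverse> = \<Delta> f\<close>, and \<open>\<Delta>\<close> lies in \<open>\<Gamma>\<^bsup>k+1\<^esup>\<close> because \<open>f\<close> lies in \<open>\<Gamma>\<^bsup>k\<^esup>\<close>.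
\<close>

section \<open>Commutators and the descending central series\<close>

context group
begin

lemma commutator_closed [simp]:
  "x \<in> carrier G \<Longrightarrow> y \<in> carrier G \<Longrightarrow> commutator G x y \<in> carrier G"
  by (simp add: commutator_def)

lemma commutator_mult:
  "x \<in> carrier G \<Longrightarrow> y \<in> carrier G \<Longrightarrow> commutator G x y \<otimes> y = x \<otimes> y \<otimes> inv x"
  by (simp add: commutator_def m_assoc)

lemma commutator_swap:
  "x \<in> carrier G \<Longrightarrow> y \<in> carrier G \<Longrightarrow> commutator G x y \<otimes> (y \<otimes> x) = x \<otimes> y"
  by (simp add: commutator_def m_assoc)
    (simp add: m_assoc[symmetric])

lemma inv_commutator:
  "x \<in> carrier G \<Longrightarrow> y \<in> carrier G \<Longrightarrow> inv (commutator G x y) = commutator G y x"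
  by (simp add: commutator_def m_assoc inv_mult_group)

lemma inv_conj:
  "g \<in> carrier G \<Longrightarrow> x \<in> carrier G \<Longrightarrow> inv (g \<otimes> x \<otimes> inv g) = g \<otimes> inv x \<otimes> inv g"
  by (simp add: m_assoc inv_mult_group)

lemma conj_mult:
  assumes "g \<in> carrier G" "x \<in> carrier G" "y \<in> carrier G"
  shows "g \<otimes> (x \<otimes> y) \<otimes> inv g = (g \<otimes> x \<otimes> inv g) \<otimes> (g \<otimes> y \<otimes> inv g)"
proof -
  have "inv g \<otimes> (g \<otimes> z) = z" if "z \<in> carrier G" for z
    using that assms by (simp add: m_assoc[symmetric])
  then show ?thesis using assms by (simp add: m_assoc)
qed

lemma conj_commutator:
  assumes "g \<in> carrier G" "x \<in> carrier G" "y \<in> carrier G"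
  shows "g \<otimes> commutator G x y \<otimes> inv g =
    commutator G (g \<otimes> x \<otimes> inv g) (g \<otimes> y \<otimes> inv g)"
  using assms by (simp add: commutator_def conj_mult inv_conj)

lemma generate_conj:
  assumes S: "S \<subseteq> carrier G" and g: "g \<in> carrier G"
    and conj: "\<And>s. s \<in> S \<Longrightarrow> g \<otimes> s \<otimes> inv g \<in> generate G S"
    and m: "m \<in> generate G S"
  shows "g \<otimes> m \<otimes> inv g \<in> generate G S"
  using m
proof (induction rule: generate.induct)
  case one
  show ?case using g by (simp add: generate.one)
next
  case (incl h)
  then show ?case by (rule conj)
next
  case (inv h)
  have "inv (g \<otimes> h \<otimes> inv g) \<in> generate G S"
    using generate_m_inv_closed[OF S conj[OF inv]] .
  then show ?case using inv S g by (auto simp: inv_conj)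
next
  case (eng h1 h2)
  then have "h1 \<in> carrier G" "h2 \<in> carrier G" using generate_in_carrier[OF S] by auto
  then show ?case using eng.IH g by (simp add: conj_mult generate.eng)
qed

lemma descending_central_normal: "descending_central G q \<lhd> G"
proof (induction G\<equiv>G q rule: descending_central.induct)
  case (3 q)
  then interpret N: normal "descending_central G (Suc q)" G by simp
  show ?case
    unfolding descending_central.simps commutator_subgroup_def
  proof (rule normal_generateI)
    show "{commutator G a b |a b. a \<in> descending_central G (Suc q) \<and> b \<in> carrier G} \<subseteq> carrier G"
      using N.subset by auto
    fix h g
    assume h: "h \<in> {commutator G a b |a b. a \<in> descending_central G (Suc q) \<and> b \<in> carrier G}"
      and g: "g \<in> carrier G"
    from h obtain a b where ab: "h = commutator G a b" "a \<in> descending_central G (Suc q)"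
      "b \<in> carrier G" by blast
    then have "g \<otimes> h \<otimes> inv g = commutator G (g \<otimes> a \<otimes> inv g) (g \<otimes> b \<otimes> inv g)"
      using g N.subset by (auto simp: conj_commutator)
    moreover have "g \<otimes> a \<otimes> inv g \<in> descending_central G (Suc q)"
      using N.inv_op_closed2 g ab by blast
    ultimately show "g \<otimes> h \<otimes> inv g \<in>
        {commutator G a b |a b. a \<in> descending_central G (Suc q) \<and> b \<in> carrier G}"
      using g ab by blast
  qed
qed (simp_all add: normal_inv_iff subgroup_self)

lemma descending_central_closed: "x \<in> descending_central G q \<Longrightarrow> x \<in> carrier G"
  using normal_imp_subgroup[OF descending_central_normal] subgroup.mem_carrier by metis

text \<open>The series is built from \<open>[\<Gamma>\<^bsup>q\<^esup>, G]\<close>; since \<open>[g, x] = [x, g]\<inverse>\<close>, the order does not matter.\<close>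

lemma commutator_in_descending_central:
  assumes "q \<ge> 1" "g \<in> carrier G" "x \<in> descending_central G q"
  shows "commutator G g x \<in> descending_central G (Suc q)"
proof -
  obtain r where r: "q = Suc r" using assms(1) by (cases q) auto
  interpret N: normal "descending_central G (Suc q)" G by (rule descending_central_normal)
  have "commutator G x g \<in> descending_central G (Suc q)"
    using assms unfolding r descending_central.simps commutator_subgroup_def
    by (blast intro: generate.incl)
  then have "inv (commutator G x g) \<in> descending_central G (Suc q)"
    by (rule N.m_inv_closed)
  then show ?thesis using assms descending_central_closed by (simp add: inv_commutator)
qed

lemma descending_central_Suc_subset:
  "descending_central G (Suc q) \<subseteq> descending_central G q"
proof (cases q)
  case (Suc r)
  interpret N: normal "descending_central G q" G by (rule descending_central_normal)
  have "{commutator G a b |a b. a \<in> descending_central G q \<and> b \<in> carrier G}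
      \<subseteq> descending_central G q"
  proof safe
    fix a b assume a: "a \<in> descending_central G q" and b: "b \<in> carrier G"
    have "a \<otimes> (b \<otimes> inv a \<otimes> inv b) \<in> descending_central G q"
      using a N.m_closed N.inv_op_closed2[OF b N.m_inv_closed[OF a]] by blast
    then show "commutator G a b \<in> descending_central G q"
      using a b by (simp add: commutator_def m_assoc)
  qed
  from generate_subgroup_incl[OF this N.subgroup_axioms] show ?thesis
    by (simp add: Suc commutator_subgroup_def)
qed simp

lemma descending_central_antimono:
  "q \<le> r \<Longrightarrow> descending_central G r \<subseteq> descending_central G q"
  using lift_Suc_antimono_le[of "descending_central G"] descending_central_Suc_subset by blast

lemma gr_class_eq_one:
  assumes "x \<in> descending_central G (Suc q)"
  shows "gr_class G q x = \<one>\<^bsub>gr G q\<^esub>"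
proof -
  have "descending_central G (Suc q) #> x = descending_central G (Suc q)"
    by (rule coset_join2)
      (use assms descending_central_closed normal_imp_subgroup[OF descending_central_normal] in auto)
  then show ?thesis by (simp add: gr_class_def gr_def r_coset_def FactGroup_def)
qed

lemma nested_commutator_Cons:
  "xs \<noteq> [] \<Longrightarrow> nested_commutator G (x # xs) = commutator G x (nested_commutator G xs)"
  by (cases xs) auto

lemma nested_commutator_descending_central:
  "xs \<noteq> [] \<Longrightarrow> set xs \<subseteq> carrier G
    \<Longrightarrow> nested_commutator G xs \<in> descending_central G (length xs)"
proof (induction xs)
  case (Cons x xs)
  show ?case
  proof (cases "xs = []")
    case False
    then have "commutator G x (nested_commutator G xs) \<in> descending_central G (Suc (length xs))"
      using Cons by (intro commutator_in_descending_central) (auto simp: Suc_le_eq)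
    then show ?thesis using False by (simp add: nested_commutator_Cons)
  qed (use Cons.prems in simp)
qed simp

end


section \<open>Nested commutators generate the kernel\<close>

text \<open>
  The commutators \<open>[g\<^sub>1, [g\<^sub>2, [\<dots>, g\<^sub>k]\<dots>]]\<close> with \<open>k \<ge> 2\<close> and entries in the factors that lie in the
  kernel of the projection to the direct product.  Entries may repeat and may come from the same
  factor, so in general this is far from a free basis; the surplus makes the set stable under
  \<open>s \<mapsto> [a, s]\<close> for every \<open>a\<close> in a factor.
\<close>

definition kernel_commutators ::
    "'i set \<Rightarrow> ('i \<Rightarrow> ('a, 'b) monoid_scheme) \<Rightarrow> ('i \<times> 'a) list set set" where
  "kernel_commutators I G =
     kernel (free_product I G) (product_group I G) (free_product_proj I G)
       \<inter> (\<Union>k\<in>{2..}. nested_commutators I G k)"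

context group_family
begin

abbreviation "P \<equiv> free_product I G"
abbreviation "letter \<equiv> free_product_incl I G"
abbreviation "M \<equiv> generate P (kernel_commutators I G)"

sublocale P: group P
  by (rule group_free_product)

sublocale proj: kernel_conj P "product_group I G" "free_product_proj I G"
  by (intro kernel_conj.intro group_hom.intro group_hom_axioms.intro
      group_free_product product_group grp free_product_proj_hom)

lemma letter_closed [simp]: "i \<in> I \<Longrightarrow> x \<in> carrier (G i) \<Longrightarrow> letter i x \<in> carrier P"
  by (simp add: free_product_incl_def class_in_carrier)

lemma class_Cons:
  "i \<in> I \<Longrightarrow> x \<in> carrier (G i) \<Longrightarrow> w \<in> W \<Longrightarrow> R `` {(i, x) # w} = letter i x \<otimes>\<^bsub>P\<^esub> R `` {w}"
  using class_mult[of "[(i, x)]" w] by (simp add: free_product_incl_def)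

lemma one_free_product: "\<one>\<^bsub>P\<^esub> = R `` {[]}"
  by (simp add: free_product_def)

lemma letter_one: "i \<in> I \<Longrightarrow> letter i \<one>\<^bsub>G i\<^esub> = \<one>\<^bsub>P\<^esub>"
  using hom_one[OF free_product_incl_hom grp group_free_product] .

lemma nested_commutators_descending_central:
  assumes "k \<ge> 1" "f \<in> nested_commutators I G k"
  shows "f \<in> descending_central P k"
proof -
  obtain w where w: "f = nested_commutator P (map (\<lambda>(i, x). letter i x) w)"
    "length w = k" "w \<in> W"
    using assms(2) by (auto simp: nested_commutators_def)
  have "set (map (\<lambda>(i, x). letter i x) w) \<subseteq> carrier P"
    using w(3) by (auto simp: free_words_def)
  with P.nested_commutator_descending_central[OF _ this] w assms(1) show ?thesis by fastforce
qed

lemma letter_commutator_nested: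
  assumes "i \<in> I" "a \<in> carrier (G i)" "k \<ge> 1" "f \<in> nested_commutators I G k"
  shows "commutator P (letter i a) f \<in> nested_commutators I G (Suc k)"
proof -
  obtain w where w: "f = nested_commutator P (map (\<lambda>(i, x). letter i x) w)"
    "length w = k" "w \<in> W"
    using assms(4) by (auto simp: nested_commutators_def)
  then have "map (\<lambda>(i, x). letter i x) w \<noteq> []" using assms(3) by auto
  then have "commutator P (letter i a) f
      = nested_commutator P (map (\<lambda>(i, x). letter i x) ((i, a) # w))"
    by (simp add: w P.nested_commutator_Cons)
  moreover have "length ((i, a) # w) = Suc k \<and> (i, a) # w \<in> W" using w assms by simp
  ultimately show ?thesis unfolding nested_commutators_def by blast
qed

lemma letter_in_nested_commutators:
  "i \<in> I \<Longrightarrow> a \<in> carrier (G i) \<Longrightarrow> letter i a \<in> nested_commutators I G 1"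
  unfolding nested_commutators_def by (intro CollectI exI[of _ "[(i, a)]"]) simp

lemma kernel_commutators_subset: "kernel_commutators I G \<subseteq> proj.N"
  by (auto simp: kernel_commutators_def)

lemma kernel_commutators_carrier: "kernel_commutators I G \<subseteq> carrier P"
  using kernel_commutators_subset proj.N_closed by blast

lemma generate_kernel_commutators_subset: "M \<subseteq> proj.N"
  by (rule P.generate_subgroup_incl[OF kernel_commutators_subset proj.subgroup_kernel])

lemma letter_commutator_kernel_commutators:
  assumes "i \<in> I" "a \<in> carrier (G i)" "s \<in> kernel_commutators I G"
  shows "commutator P (letter i a) s \<in> kernel_commutators I G"
proof -
  have s: "s \<in> proj.N" "s \<in> carrier P"
    using assms kernel_commutators_subset kernel_commutators_carrier by auto
  obtain k where k: "k \<ge> 2" "s \<in> nested_commutators I G k"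
    using assms by (auto simp: kernel_commutators_def)
  have "commutator P (letter i a) s \<in> nested_commutators I G (Suc k)"
    using letter_commutator_nested assms k by simp
  moreover have "commutator P (letter i a) s \<in> proj.N"
    unfolding commutator_def
    using proj.conj_in_N[of "letter i a" s] assms s proj.subgroup_kernel
    by (simp add: subgroup.m_closed subgroup.m_inv_closed)
  ultimately show ?thesis using k by (fastforce simp: kernel_commutators_def)
qed

lemma letter_conj_generate_kernel_commutators:
  assumes i: "i \<in> I" "a \<in> carrier (G i)" and m: "m \<in> M"
  shows "letter i a \<otimes>\<^bsub>P\<^esub> m \<otimes>\<^bsub>P\<^esub> inv\<^bsub>P\<^esub> letter i a \<in> M"
proof (rule P.generate_conj[OF kernel_commutators_carrier _ _ m])
  fix s assume s: "s \<in> kernel_commutators I G"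
  have "commutator P (letter i a) s \<otimes>\<^bsub>P\<^esub> s \<in> M"
    using letter_commutator_kernel_commutators[OF i s] s
    by (intro generate.eng generate.incl)
  then show "letter i a \<otimes>\<^bsub>P\<^esub> s \<otimes>\<^bsub>P\<^esub> inv\<^bsub>P\<^esub> letter i a \<in> M"
    using P.commutator_mult[OF letter_closed[OF i] subsetD[OF kernel_commutators_carrier s]]
    by simp
qed (use i in simp)

lemma proj_letter_apply:
  assumes "j \<in> I" "b \<in> carrier (G j)" "i \<in> I"
  shows "free_product_proj I G (letter j b) i = (if i = j then b else \<one>\<^bsub>G i\<^esub>)"
  using assms by (simp add: free_product_proj_incl product_incl_def)

lemma proj_mult_apply:
  assumes "x \<in> carrier P" "y \<in> carrier P" "i \<in> I"
  shows "free_product_proj I G (x \<otimes>\<^bsub>P\<^esub> y) i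
    = free_product_proj I G x i \<otimes>\<^bsub>G i\<^esub> free_product_proj I G y i"
  using assms hom_mult[OF free_product_proj_hom] by simp

lemma proj_inv_apply:
  assumes "x \<in> carrier P" "i \<in> I"
  shows "free_product_proj I G (inv\<^bsub>P\<^esub> x) i = inv\<^bsub>G i\<^esub> (free_product_proj I G x i)"
proof -
  have "free_product_proj I G x \<in> carrier (product_group I G)"
    using assms by (simp add: proj.hom_closed del: carrier_product_group)
  then show ?thesis using assms grp by (simp add: proj.hom_inv)
qed

lemma proj_kernelI:
  assumes "x \<in> carrier P" "\<And>i. i \<in> I \<Longrightarrow> free_product_proj I G x i = \<one>\<^bsub>G i\<^esub>"
  shows "x \<in> proj.N"
proof -
  have "free_product_proj I G x \<in> carrier (product_group I G)"
    using assms by (simp add: proj.hom_closed del: carrier_product_group)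
  then have "free_product_proj I G x = (\<lambda>i\<in>I. \<one>\<^bsub>G i\<^esub>)"
    using assms(2) by (intro extensionalityI[of _ I]) (auto simp: PiE_def)
  then show ?thesis using assms(1) by (simp add: kernel_def)
qed

lemma proj_kernelD:
  "x \<in> proj.N \<Longrightarrow> i \<in> I \<Longrightarrow> free_product_proj I G x i = \<one>\<^bsub>G i\<^esub>"
  by (simp add: kernel_def)

lemma commutator_letters_kernel_commutators:
  assumes "i \<in> I" "a \<in> carrier (G i)" "j \<in> I" "b \<in> carrier (G j)" "i \<noteq> j"
  shows "commutator P (letter j b) (letter i a) \<in> kernel_commutators I G"
proof -
  have "commutator P (letter j b) (letter i a) \<in> nested_commutators I G (Suc 1)"
    using letter_commutator_nested letter_in_nested_commutators assms by simp
  moreover have "commutator P (letter j b) (letter i a) \<in> proj.N"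
  proof (rule proj_kernelI)
    fix l assume l: "l \<in> I"
    interpret Gl: group "G l" using grp l .
    interpret Gi: group "G i" using grp assms(1) .
    show "free_product_proj I G (commutator P (letter j b) (letter i a)) l = \<one>\<^bsub>G l\<^esub>"
      using assms l by (simp add: commutator_def proj_mult_apply proj_inv_apply proj_letter_apply
          del: proj.hom_inv)
  qed (use assms in simp)
  ultimately show ?thesis by (auto simp: kernel_commutators_def)
qed

text \<open>Modulo \<open>M\<close>, the letters of the factor \<open>i\<close> can be collected into one letter at the front.\<close>

lemma collect_letters:
  assumes i: "i \<in> I" and "w \<in> W"
  shows "\<exists>m\<in>M. \<exists>a\<in>carrier (G i).
    R `` {w} = m \<otimes>\<^bsub>P\<^esub> (letter i a \<otimes>\<^bsub>P\<^esub> R `` {filter (\<lambda>l. fst l \<noteq> i) w})"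
  using assms(2)
proof (induction w)
  interpret Gi: group "G i" using grp i .
  case Nil
  have "R `` {[]} = \<one>\<^bsub>P\<^esub> \<otimes>\<^bsub>P\<^esub> (letter i \<one>\<^bsub>G i\<^esub> \<otimes>\<^bsub>P\<^esub> R `` {[]})"
    using i by (simp add: letter_one one_free_product[symmetric])
  then show ?case using generate.one[of P] Gi.one_closed
    unfolding filter.simps by blast
next
  interpret Gi: group "G i" using grp i .
  case (Cons l w)
  obtain j b where l: "l = (j, b)" by force
  then have j: "j \<in> I" "b \<in> carrier (G j)" and w: "w \<in> W" using Cons.prems by auto
  let ?w = "filter (\<lambda>l. fst l \<noteq> i) w"
  have w': "?w \<in> W" using w by (auto simp: free_words_def)
  then have wc: "R `` {?w} \<in> carrier P" by (rule class_in_carrier)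
  obtain m a where m: "m \<in> M" and a: "a \<in> carrier (G i)"
    and eq: "R `` {w} = m \<otimes>\<^bsub>P\<^esub> (letter i a \<otimes>\<^bsub>P\<^esub> R `` {?w})"
    using Cons.IH w by blast
  have mc: "m \<in> carrier P" using m P.generate_in_carrier kernel_commutators_carrier by blast
  define m' where "m' = letter j b \<otimes>\<^bsub>P\<^esub> m \<otimes>\<^bsub>P\<^esub> inv\<^bsub>P\<^esub> letter j b"
  have m': "m' \<in> M" unfolding m'_def by (rule letter_conj_generate_kernel_commutators[OF j m])
  have m'c: "m' \<in> carrier P" using j mc by (simp add: m'_def)
  have step: "R `` {l # w} = m' \<otimes>\<^bsub>P\<^esub> (letter j b \<otimes>\<^bsub>P\<^esub> letter i a \<otimes>\<^bsub>P\<^esub> R `` {?w})"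
  proof -
    have "R `` {l # w} = (letter j b \<otimes>\<^bsub>P\<^esub> m) \<otimes>\<^bsub>P\<^esub> (letter i a \<otimes>\<^bsub>P\<^esub> R `` {?w})"
      using j w i a wc mc by (simp add: l class_Cons eq P.m_assoc)
    also have "letter j b \<otimes>\<^bsub>P\<^esub> m = m' \<otimes>\<^bsub>P\<^esub> letter j b"
      using j mc by (simp add: m'_def P.m_assoc)
    finally show ?thesis using j i a wc m'c by (simp add: P.m_assoc)
  qed
  show ?case
  proof (cases "j = i")
    case True
    have "letter j b \<otimes>\<^bsub>P\<^esub> letter i a = letter i (b \<otimes>\<^bsub>G i\<^esub> a)"
      using hom_mult[OF free_product_incl_hom[OF i]] a j True by simp
    then have "R `` {l # w} = m' \<otimes>\<^bsub>P\<^esub> (letter i (b \<otimes>\<^bsub>G i\<^esub> a) \<otimes>\<^bsub>P\<^esub> R `` {filter (\<lambda>l. fst l \<noteq> i) (l # w)})"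
      using step True l by simp
    moreover have "b \<otimes>\<^bsub>G i\<^esub> a \<in> carrier (G i)" using a j True by simp
    ultimately show ?thesis using m' by blast
  next
    case False
    define c where "c = commutator P (letter j b) (letter i a)"
    have "c \<in> kernel_commutators I G"
      unfolding c_def using commutator_letters_kernel_commutators False i a j by simp
    then have c: "m' \<otimes>\<^bsub>P\<^esub> c \<in> M" "c \<in> carrier P"
      using m' kernel_commutators_carrier by (auto intro: generate.intros)
    have "letter j b \<otimes>\<^bsub>P\<^esub> letter i a = c \<otimes>\<^bsub>P\<^esub> (letter i a \<otimes>\<^bsub>P\<^esub> letter j b)"
      using P.commutator_swap i j a by (simp add: c_def)
    then have "R `` {l # w} = (m' \<otimes>\<^bsub>P\<^esub> c) \<otimes>\<^bsub>P\<^esub> (letter i a \<otimes>\<^bsub>P\<^esub> (letter j b \<otimes>\<^bsub>P\<^esub> R `` {?w}))"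
      using step i j a c m'c wc by (simp add: P.m_assoc)
    also have "letter j b \<otimes>\<^bsub>P\<^esub> R `` {?w} = R `` {filter (\<lambda>l. fst l \<noteq> i) (l # w)}"
      using False l j w' by (simp add: class_Cons)
    finally show ?thesis using c(1) a by blast
  qed
qed

lemma proj_absent_factor:
  assumes "w \<in> W" "i \<in> I" "i \<notin> fst ` set w"
  shows "free_product_proj I G (R `` {w}) i = \<one>\<^bsub>G i\<^esub>"
  using assms(1,3)
proof (induction w)
  case Nil
  show ?case using assms(2) by (simp add: one_free_product[symmetric])
next
  interpret Gi: group "G i" using grp assms(2) .
  case (Cons l w)
  then show ?case using assms(2)
    by (cases l) (simp add: class_Cons class_in_carrier proj_mult_apply proj_letter_apply)
qed

lemma kernel_words_generated:
  assumes "finite J"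
  shows "w \<in> W \<Longrightarrow> fst ` set w \<subseteq> J \<Longrightarrow> R `` {w} \<in> proj.N \<Longrightarrow> R `` {w} \<in> M"
  using assms
proof (induction J arbitrary: w rule: finite_induct)
  case empty
  then have "R `` {w} = \<one>\<^bsub>P\<^esub>" by (simp add: one_free_product)
  then show ?case by (simp add: generate.one)
next
  case (insert i J)
  show ?case
  proof (cases "i \<in> I")
    case False
    then have "i \<notin> fst ` set w" using insert.prems by (auto simp: free_words_def)
    then show ?thesis using insert by blast
  next
    case i: True
    interpret Gi: group "G i" using grp i .
    let ?w = "filter (\<lambda>l. fst l \<noteq> i) w"
    have w': "?w \<in> W" using insert.prems by (auto simp: free_words_def)
    then have wc: "R `` {?w} \<in> carrier P" by (rule class_in_carrier)
    obtain m a where m: "m \<in> M" and a: "a \<in> carrier (G i)"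
      and eq: "R `` {w} = m \<otimes>\<^bsub>P\<^esub> (letter i a \<otimes>\<^bsub>P\<^esub> R `` {?w})"
      using collect_letters[OF i insert.prems(1)] by blast
    have mN: "m \<in> proj.N" using m generate_kernel_commutators_subset by blast
    then have mc: "m \<in> carrier P" by (rule proj.N_closed)
    have "i \<notin> fst ` set ?w" by auto
    note absent = proj_absent_factor[OF w' i this]
    \<comment> \<open>The component of index \<open>i\<close> of the projection reads off the collected letter.\<close>
    have "free_product_proj I G (R `` {w}) i = a"
      using i a wc mc proj_kernelD[OF mN i] absent
      unfolding eq by (simp del: set_filter add: proj_mult_apply proj_letter_apply)
    then have "a = \<one>\<^bsub>G i\<^esub>" using proj_kernelD[OF insert.prems(3) i] by simp
    then have eq': "R `` {w} = m \<otimes>\<^bsub>P\<^esub> R `` {?w}" using eq i wc by (simp add: letter_one)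
    then have "R `` {?w} = inv\<^bsub>P\<^esub> m \<otimes>\<^bsub>P\<^esub> R `` {w}"
      using mc wc by (simp add: P.m_assoc[symmetric])
    then have "R `` {?w} \<in> proj.N"
      using mN insert.prems(3) proj.subgroup_kernel
      by (simp add: subgroup.m_closed subgroup.m_inv_closed)
    moreover have "fst ` set ?w \<subseteq> J" using insert.prems(2) by auto
    ultimately have "R `` {?w} \<in> M" using insert.IH w' by blast
    then show ?thesis unfolding eq' using m by (intro generate.eng)
  qed
qed

theorem generate_kernel_commutators: "M = proj.N"
proof
  show "proj.N \<subseteq> M"
  proof
    fix x assume x: "x \<in> proj.N"
    then obtain w where w: "w \<in> W" "x = R `` {w}" using carrier_cases proj.N_closed by metis
    then show "x \<in> M" using kernel_words_generated[of "fst ` set w" w] x by simp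
  qed
qed (rule generate_kernel_commutators_subset)

end


section \<open>The action on the kernel\<close>

theorem lemma1p3:
  fixes n :: nat and G :: "nat \<Rightarrow> ('a, 'b) monoid_scheme"
  assumes grp: "\<And>i. i \<in> {1..n} \<Longrightarrow> group (G i)"
    and fin: "\<And>i. i \<in> {1..n} \<Longrightarrow> finite (carrier (G i))"
  defines "P \<equiv> free_product {1..n} G"
    and "Q \<equiv> product_group {1..n} G"
    and "p \<equiv> free_product_proj {1..n} G"
  defines "F \<equiv> kernel_group P Q p"
    and "\<rho> \<equiv> monodromy P Q p"
    and "conjF \<equiv> conj_aut P (kernel P Q p)"
  shows "(\<exists>S \<subseteq> carrier F. generate F S = carrier F \<and>
        (\<forall>f\<in>S. \<exists>k\<ge>2. f \<in> nested_commutators {1..n} G k \<and> f \<in> descending_central P k))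
    \<and> (\<forall>g\<in>carrier P.
        conjF g \<in> auto F \<and> \<rho> (p g) = outer_class F (conjF g) \<and>
        (\<forall>k\<ge>2. \<forall>f \<in> nested_commutators {1..n} G k \<inter> carrier F.
          \<exists>\<Delta> \<in> descending_central P (k + 1).
            conjF g f = \<Delta> \<otimes>\<^bsub>P\<^esub> f \<and>
            (\<forall>q\<in>{1..k}. \<Delta> \<in> descending_central P q \<and> gr_class P q \<Delta> = \<one>\<^bsub>gr P q\<^esub>)))"
proof -
  interpret fam: group_family "{1..n}" G by (rule group_family.intro) (rule grp)
  interpret P: group P unfolding P_def by (rule fam.group_free_product)
  have kc: "kernel_conj P Q p" unfolding P_def Q_def p_def by (rule fam.proj.kernel_conj_axioms)
  interpret kc: kernel_conj P Q p by (rule kc)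
  have dc: "f \<in> descending_central P k" if "k \<ge> 2" "f \<in> nested_commutators {1..n} G k" for k f
    using fam.nested_commutators_descending_central that unfolding P_def by simp
  have F: "carrier F = kernel P Q p" unfolding F_def by simp
  let ?S = "kernel_commutators {1..n} G"
  have S: "?S \<subseteq> kernel P Q p"
    unfolding P_def Q_def p_def by (rule fam.kernel_commutators_subset)
  have "generate F ?S = generate P ?S"
    unfolding F_def kernel_group_def by (rule P.generate_consistent[OF S kc.subgroup_kernel])
  also have "\<dots> = carrier F"
    unfolding F P_def Q_def p_def by (rule fam.generate_kernel_commutators)
  finally have gen: "generate F ?S = carrier F" .
  have part1: "\<exists>S \<subseteq> carrier F. generate F S = carrier F \<and>
      (\<forall>f\<in>S. \<exists>k\<ge>2. f \<in> nested_commutators {1..n} G k \<and> f \<in> descending_central P k)"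
  proof (intro exI[of _ ?S] conjI ballI)
    fix f assume "f \<in> ?S"
    then obtain k where "k \<ge> 2" "f \<in> nested_commutators {1..n} G k"
      by (auto simp: kernel_commutators_def)
    then show "\<exists>k\<ge>2. f \<in> nested_commutators {1..n} G k \<and> f \<in> descending_central P k"
      using dc by blast
  qed (use S F gen in auto)
  have part2: "\<exists>\<Delta> \<in> descending_central P (k + 1). conjF g f = \<Delta> \<otimes>\<^bsub>P\<^esub> f \<and>
      (\<forall>q\<in>{1..k}. \<Delta> \<in> descending_central P q \<and> gr_class P q \<Delta> = \<one>\<^bsub>gr P q\<^esub>)"
    if g: "g \<in> carrier P" and k: "k \<ge> 2" and f: "f \<in> nested_commutators {1..n} G k" "f \<in> carrier F"
    for g k f
  proof (intro bexI[of _ "commutator P g f"] conjI ballI)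
    have fc: "f \<in> carrier P" using f F kc.N_closed by simp
    show D: "commutator P g f \<in> descending_central P (k + 1)"
      using P.commutator_in_descending_central[of k g f] dc f k g by simp
    show "conjF g f = commutator P g f \<otimes>\<^bsub>P\<^esub> f"
      using f g fc by (simp add: conjF_def conj_aut_def F P.commutator_mult)
    fix q assume q: "q \<in> {1..k}"
    show "commutator P g f \<in> descending_central P q"
      using D P.descending_central_antimono[of q "k + 1"] q by auto
    show "gr_class P q (commutator P g f) = \<one>\<^bsub>gr P q\<^esub>"
      using D P.descending_central_antimono[of "Suc q" "k + 1"] q by (intro P.gr_class_eq_one) auto
  qed
  have "conjF g \<in> auto F" "\<rho> (p g) = outer_class F (conjF g)" if "g \<in> carrier P" for g
    using kc.conj_aut_in_auto[OF that] kc.monodromy_apply[OF that]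
    unfolding F_def \<rho>_def conjF_def by simp_all
  then show ?thesis using part1 part2 by (intro conjI ballI allI impI) simp_all
qed

end
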